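(* Let $(A,\cdot_A,\ast_A)$ be an $F$-manifold-admissible algebra. Then $(A,\cdot_A,[-,-]_A)$ is an $F$-manifold algebra, where $[x,y]_A=x\ast_A y-y\ast_A x$ for all $x,y\in A$.
   Context: All vector spaces are finite dimensional over an algebraically closed field $\mathbb{K}$ of characteristic $0$. A Lie-admissible algebra is a vector space with a bilinear product $\ast$ whose commutator $[x,y]=x\ast y-y\ast x$ is a Lie bracket. An $F$-manifold-admissible algebra is a vector space $A$ with two bilinear maps $\cdot_A,\ast_A:A\times A\to A$ such that $(A,\cdot_A)$ is a commutative associative algebra, $(A,\ast_A)$ is a Lie-admissible algebra, and for all $x,y,z\in A$ $$x\ast_A(y\cdot_A z)-(x\ast_A y)\cdot_A z-y\cdot_A(x\ast_A z)=y\ast_A(x\cdot_A z)-(y\ast_A x)\cdot_A z-x\cdot_A(y\ast_A z).$$ An $F$-manifold algebra is a triple $(A,\cdot_A,[-,-]_A)$ where $(A,\cdot_A)$ is a commutative associative algebra and $(A,[-,-]_A)$ is a Lie algebra such that for all $x,y,z,w\in A$ the Hertling-Manin relation $P_{x\cdot_A y}(z,w)=x\cdot_A P_y(z,w)+y\cdot_A P_x(z,w)$ holds, where $P_x(y,z)=[x,y\cdot_A z]_A-[x,y]_A\cdot_A z-y\cdot_A[x,z]_A$. *)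

theory Defs
  imports "HOL-Computational_Algebra.Polynomial"
begin

text \<open>
  The underlying vector space of an algebra is a whole type \<open>'a\<close> with scalar
  multiplication \<open>scale\<close>.  The structures are defined over an arbitrary field and without
  restriction on the dimension.
\<close>

locale bilinear_product = vector_space scale
  for scale :: "'k::field \<Rightarrow> 'a::ab_group_add \<Rightarrow> 'a" (infixr "*s" 75) +
  fixes prd :: "'a \<Rightarrow> 'a \<Rightarrow> 'a"
  assumes linear_right: "Vector_Spaces.linear scale scale (\<lambda>y. prd x y)"
    and linear_left: "Vector_Spaces.linear scale scale (\<lambda>x. prd x y)"

text \<open>Associative algebras are not required to have a unit.\<close>

locale comm_assoc_algebra = bilinear_product scale mul
  for scale :: "'k::field \<Rightarrow> 'a::ab_group_add \<Rightarrow> 'a" (infixr "*s" 75)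
    and mul :: "'a \<Rightarrow> 'a \<Rightarrow> 'a" (infixl "\<cdot>" 70) +
  assumes mul_assoc: "(x \<cdot> y) \<cdot> z = x \<cdot> (y \<cdot> z)"
    and mul_commute: "x \<cdot> y = y \<cdot> x"

locale lie_algebra = bilinear_product scale br
  for scale :: "'k::field \<Rightarrow> 'a::ab_group_add \<Rightarrow> 'a" (infixr "*s" 75)
    and br :: "'a \<Rightarrow> 'a \<Rightarrow> 'a" +
  assumes alternating: "br x x = 0"
    and jacobi: "br x (br y z) + br y (br z x) + br z (br x y) = 0"

definition commutator :: "('a \<Rightarrow> 'a \<Rightarrow> 'a) \<Rightarrow> 'a \<Rightarrow> 'a \<Rightarrow> 'a::ab_group_add"
  where "commutator ast x y = ast x y - ast y x"

locale lie_admissible_algebra = bilinear_product scale ast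
  for scale :: "'k::field \<Rightarrow> 'a::ab_group_add \<Rightarrow> 'a" (infixr "*s" 75)
    and ast :: "'a \<Rightarrow> 'a \<Rightarrow> 'a" (infixl "\<star>" 70) +
  assumes lie_commutator: "lie_algebra scale (commutator ast)"

locale F_manifold_admissible_algebra =
  comm_assoc_algebra scale mul + ast: lie_admissible_algebra scale ast
  for scale :: "'k::field \<Rightarrow> 'a::ab_group_add \<Rightarrow> 'a" (infixr "*s" 75)
    and mul :: "'a \<Rightarrow> 'a \<Rightarrow> 'a" (infixl "\<cdot>" 70)
    and ast :: "'a \<Rightarrow> 'a \<Rightarrow> 'a" (infixl "\<star>" 70) +
  assumes admissible:
    "x \<star> (y \<cdot> z) - (x \<star> y) \<cdot> z - y \<cdot> (x \<star> z) =
     y \<star> (x \<cdot> z) - (y \<star> x) \<cdot> z - x \<cdot> (y \<star> z)"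

text \<open>The defect of the Leibniz rule, \<open>P\<^sub>x(y, z)\<close>.\<close>

definition leibniz_defect ::
    "('a \<Rightarrow> 'a \<Rightarrow> 'a) \<Rightarrow> ('a \<Rightarrow> 'a \<Rightarrow> 'a) \<Rightarrow> 'a \<Rightarrow> 'a \<Rightarrow> 'a \<Rightarrow> 'a::ab_group_add"
  where "leibniz_defect mul br x y z = br x (mul y z) - mul (br x y) z - mul y (br x z)"

locale F_manifold_algebra =
  comm_assoc_algebra scale mul + br: lie_algebra scale br
  for scale :: "'k::field \<Rightarrow> 'a::ab_group_add \<Rightarrow> 'a" (infixr "*s" 75)
    and mul :: "'a \<Rightarrow> 'a \<Rightarrow> 'a" (infixl "\<cdot>" 70)
    and br :: "'a \<Rightarrow> 'a \<Rightarrow> 'a" +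
  assumes hertling_manin:
    "leibniz_defect mul br (x \<cdot> y) z w =
     x \<cdot> leibniz_defect mul br y z w + y \<cdot> leibniz_defect mul br x z w"

end

(* Write D for the Leibniz defect of the product *.  Admissibility says exactly that
   D(x;y,z) = D(y;x,z), and associativity and commutativity of the multiplication give
   the Hochschild cocycle identity
     x D(u;y,z) - D(u;xy,z) + D(u;x,yz) - D(u;x,y) z = 0.
   The Leibniz defect of the commutator is P_x(y,z) = D(x;y,z) - R_x(y,z), where R_x is the
   Leibniz defect of right multiplication by x.  Expanding P_{xy}(z,w) in terms of D, the
   symmetry and two cocycle identities cancel everything but x P_y(z,w) + y P_x(z,w). *)

theory Submission
  imports Defs
begin

context bilinear_product
begin

lemmas module_hom_right = Vector_Spaces.linear.axioms(3)[OF linear_right]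
lemmas module_hom_left = Vector_Spaces.linear.axioms(3)[OF linear_left]

lemmas prd_right_add = module_hom.add[OF module_hom_right]
lemmas prd_right_diff = module_hom.diff[OF module_hom_right]
lemmas prd_left_add = module_hom.add[OF module_hom_left]
lemmas prd_left_diff = module_hom.diff[OF module_hom_left]

end

context comm_assoc_algebra
begin

lemma mul_left_commute: "x \<cdot> (y \<cdot> z) = y \<cdot> (x \<cdot> z)"
  by (metis mul_assoc mul_commute)

lemmas mul_ac = mul_assoc mul_commute mul_left_commute
lemmas mul_distribs = prd_right_add prd_right_diff prd_left_add prd_left_diff

text \<open>Up to sign, \<open>leibniz_defect mul br u\<close> is the Hochschild coboundary of the
  map \<open>br u\<close>, hence closed.\<close>

lemma leibniz_defect_cocycle:
  "leibniz_defect mul br u (x \<cdot> y) z =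
   leibniz_defect mul br u x (y \<cdot> z) + x \<cdot> leibniz_defect mul br u y z
     - z \<cdot> leibniz_defect mul br u x y"
  by (simp add: leibniz_defect_def mul_distribs mul_ac algebra_simps)

lemma br_mul_eq_leibniz_defect:
  "br x (y \<cdot> z) = leibniz_defect mul br x y z + br x y \<cdot> z + y \<cdot> br x z"
  by (simp add: leibniz_defect_def)

lemma leibniz_defect_commutator:
  "leibniz_defect mul (commutator ast) x y z =
   leibniz_defect mul ast x y z - ast (y \<cdot> z) x + ast y x \<cdot> z + y \<cdot> ast z x"
  by (simp add: leibniz_defect_def commutator_def mul_distribs algebra_simps)

end

context F_manifold_admissible_algebra
begin

lemma leibniz_defect_swap_left:
  "leibniz_defect mul ast x y z = leibniz_defect mul ast y x z"
  using admissible by (simp add: leibniz_defect_def)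

text \<open>The three terms beyond the Hertling-Manin pattern are those that right multiplication by
  \<open>x \<cdot> y\<close> contributes to the commutator's defect with the opposite sign.\<close>

lemma leibniz_defect_mul_left:
  "leibniz_defect mul ast (x \<cdot> y) z w =
   leibniz_defect mul ast (z \<cdot> w) x y
     + x \<cdot> leibniz_defect mul ast y z w + y \<cdot> leibniz_defect mul ast x z w
     - z \<cdot> leibniz_defect mul ast w x y - w \<cdot> leibniz_defect mul ast z x y"
proof -
  let ?D = "leibniz_defect mul ast"
  \<comment> \<open>Symmetry moves the product out of the first slot, where the cocycle identity can
    split it.\<close>
  have "?D (x \<cdot> y) z w = ?D z x (y \<cdot> w) + x \<cdot> ?D z y w - w \<cdot> ?D z x y"
    by (metis leibniz_defect_swap_left leibniz_defect_cocycle)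
  moreover have "?D x z (w \<cdot> y) = ?D (z \<cdot> w) x y + y \<cdot> ?D x z w - z \<cdot> ?D x w y"
    using leibniz_defect_cocycle[of ast x z w y] leibniz_defect_swap_left[of "z \<cdot> w" x y]
    by (simp add: algebra_simps)
  moreover have "?D z x (y \<cdot> w) = ?D x z (w \<cdot> y)"
    by (metis leibniz_defect_swap_left mul_commute)
  ultimately show ?thesis
    using leibniz_defect_swap_left[of z y w] leibniz_defect_swap_left[of x w y]
    by (simp add: algebra_simps)
qed

lemma hertling_manin_commutator:
  "leibniz_defect mul (commutator ast) (x \<cdot> y) z w =
   x \<cdot> leibniz_defect mul (commutator ast) y z w
     + y \<cdot> leibniz_defect mul (commutator ast) x z w"
  \<comment> \<open>The instance is fixed because the general rule would rewrite its own term
    \<open>leibniz_defect mul ast (z \<cdot> w) x y\<close> and loop.\<close>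
  unfolding leibniz_defect_commutator leibniz_defect_mul_left[of x y z w]
    br_mul_eq_leibniz_defect[of ast _ x y]
  by (simp add: mul_distribs mul_ac algebra_simps)

lemma F_manifold_algebra_commutator: "F_manifold_algebra scale mul (commutator ast)"
  by (intro F_manifold_algebra.intro F_manifold_algebra_axioms.intro
      comm_assoc_algebra_axioms ast.lie_commutator hertling_manin_commutator)

end

theorem theorem3p14:
  fixes scale :: "'k::{alg_closed_field, field_char_0} \<Rightarrow> 'a::ab_group_add \<Rightarrow> 'a"
    and Basis :: "'a set"
    and mul ast :: "'a \<Rightarrow> 'a \<Rightarrow> 'a"
  assumes "finite_dimensional_vector_space scale Basis"
    and "F_manifold_admissible_algebra scale mul ast"
  shows "F_manifold_algebra scale mul (\<lambda>x y. ast x y - ast y x)"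
  using F_manifold_admissible_algebra.F_manifold_algebra_commutator[OF assms(2)]
  unfolding commutator_def .

end
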